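(* Let $(G,+)$ be a finite abelian group of odd order. Let $\Sigma$ be a $(G,k,\mu)$-SDF where $k\equiv0,1\pmod4$ and $\Sigma$ is the (multiset) union of two families $\Sigma_1$ and $\Sigma_2$ ($\Sigma_2$ could be empty) such that: 1) $\Sigma_1$ consists of only one base block, of the form $[x_{1},x_{1},-x_{1},-x_{1},\dots,x_{k/4},x_{k/4},-x_{k/4},-x_{k/4}]$ if $k\equiv0\pmod4$, and $[0,x_{1},x_{1},-x_{1},-x_{1},\dots,x_{\lfloor k/4\rfloor},x_{\lfloor k/4\rfloor},-x_{\lfloor k/4\rfloor},-x_{\lfloor k/4\rfloor}]$ if $k\equiv1\pmod4$, such that $\Delta[x_1,-x_1,x_2,-x_2,\dots,x_{\lfloor k/4\rfloor},-x_{\lfloor k/4\rfloor}]$ does not contain zeros; 2) for every $A\in\Sigma_2$, the multiplicity of $A$ in $\Sigma_2$ is doubly even (divisible by 4) and $\Delta A$ does not contain zeros. Then $\Sigma$ is of type $4$.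
   Context: Square brackets denote multisets; all unions of multisets preserve multiplicities; $\underline{h}A$ denotes the union of $h$ copies of $A$. If $A,B$ are multisets on a multiplicative group, $A\cdot B:=[ab:a\in A,b\in B]$ (a multiset). For a multiset (or set) $F$ with elements $f_1,\dots,f_k$ in a group written additively, $\Delta F:=[f_a-f_b:1\le a,b\le k,\ a\ne b]$, and for a family, $\Delta$ is the multiset union of $\Delta$ over its members. A $(G,k,\mu)$ strong difference family (SDF) is a family $\Sigma$ of multisets of size $k$ (called base blocks) of a finite group $(G,+)$ such that $\Delta\Sigma=\underline{\mu}G$, i.e. every element of $G$ (0 included) appears exactly $\mu$ times in $\Delta\Sigma$. $\mathbb{F}_q$ is the finite field of order $q$, $\mathbb{F}_q^*$ its multiplicative group; if $q\equiv1\pmod e$, $C_0^{e,q}$ denotes the group of nonzero $e$th powers of $\mathbb{F}_q$. Type: for a divisor $d$ of $\mu$ and a prime power $q\equiv1\pmod d$, a $(G,k,\mu)$-SDF $\Sigma$ is of type $d$ with respect to $q$ if there is a collection $\mathfrak{C}$ of subsets of $G\times\mathbb{F}_q$ such that 1) the projection of $\mathfrak{C}$ on $G$ (each member projected as a multiset) coincides with $\Sigma$; 2) $\Delta\mathfrak{C}=\bigcup_{g\in G}(\{g\}\times D_g)$, where $D_g=C_0^{(q-1)/d,q}\cdot L_g$ and $L_g$ is a multiset of size $\mu/d$ on $\mathbb{F}_q^*$. $\Sigma$ is simply said to be of type $d$ if this holds for any prime power $q\equiv1\pmod d$.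
   Formalization: Type 4 is proved for every prime power q ≡ 1 (mod 4) with q ≥ k; for q < k it is impossible, since no difference may have second coordinate 0 (e.g. the (Z_13,13,12)-SDF of 0 and twice each nonzero square fails at q = 5). *)

theory Defs
  imports
    "HOL-Library.Multiset"
    "HOL-Library.Product_Plus"
    "HOL-Library.Cardinality"
    "HOL-Number_Theory.Cong"
begin

text \<open>
  Differences are taken over ordered pairs of distinct \<^emph>\<open>positions\<close>: removing one copy
  of \<open>x\<close> before forming \<open>x - y\<close> keeps the zero differences that come from repeated elements.
\<close>
definition diff_list :: "'a::group_add multiset \<Rightarrow> 'a multiset" where
  "diff_list F = (\<Sum>x\<in>#F. image_mset (\<lambda>y. x - y) (F - {#x#}))"

definition family_diff_list :: "'a::group_add multiset multiset \<Rightarrow> 'a multiset" where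
  "family_diff_list \<Sigma> = (\<Sum>F\<in>#\<Sigma>. diff_list F)"

definition strong_difference_family ::
    "nat \<Rightarrow> nat \<Rightarrow> 'g::{finite, group_add} multiset multiset \<Rightarrow> bool" where
  "strong_difference_family k \<mu> \<Sigma> \<longleftrightarrow>
     (\<forall>A\<in>#\<Sigma>. size A = k) \<and> family_diff_list \<Sigma> = repeat_mset \<mu> (mset_set UNIV)"

definition mset_mult :: "'a::times multiset \<Rightarrow> 'a multiset \<Rightarrow> 'a multiset" where
  "mset_mult A B = (\<Sum>a\<in>#A. image_mset (\<lambda>b. a * b) B)"

definition nonzero_powers :: "nat \<Rightarrow> 'f::field set" where
  "nonzero_powers e = {x ^ e | x. x \<noteq> 0}"

text \<open>
  The field of order \<open>q\<close> is the type \<open>'f\<close>, so \<open>q = CARD('f)\<close>; it is unique up to isomorphism.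
  The collection of subsets is a multiset of sets, since base blocks may be repeated.
\<close>
definition sdf_of_type_wrt ::
    "'f::{finite, field} itself \<Rightarrow> nat \<Rightarrow> nat \<Rightarrow> nat \<Rightarrow> 'g::{finite, group_add} multiset multiset \<Rightarrow> bool"
  where
  "sdf_of_type_wrt F d k \<mu> \<Sigma> \<longleftrightarrow>
     strong_difference_family k \<mu> \<Sigma> \<and> d dvd \<mu> \<and> [CARD('f) = 1] (mod d) \<and>
     (\<exists>(\<CC> :: ('g \<times> 'f) set multiset) (L :: 'g \<Rightarrow> 'f multiset).
        image_mset (\<lambda>B. image_mset fst (mset_set B)) \<CC> = \<Sigma> \<and>
        (\<forall>g. size (L g) = \<mu> div d \<and> 0 \<notin># L g) \<and>
        family_diff_list (image_mset mset_set \<CC>) =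
          (\<Sum>g\<in>UNIV. image_mset (Pair g)
             (mset_mult (mset_set (nonzero_powers ((CARD('f) - 1) div d))) (L g))))"

text \<open>
  No difference of two distinct points of a member of the collection has second coordinate \<open>0\<close>,
  so a family of type \<open>d\<close> with respect to \<open>q\<close> has block size at most \<open>q\<close>.  Hence being of
  type \<open>d\<close> can only be asked for prime powers \<open>q \<ge> k\<close>.
\<close>
lemma sdf_of_type_wrt_imp_le:
  fixes \<Sigma> :: "'g::{finite, group_add} multiset multiset"
  assumes "sdf_of_type_wrt TYPE('f::{finite, field}) d k \<mu> \<Sigma>" and "\<Sigma> \<noteq> {#}"
  shows "k \<le> CARD('f)"
proof -
  from assms(1) obtain C :: "('g \<times> 'f) set multiset" and L :: "'g \<Rightarrow> 'f multiset" where
    sdf: "strong_difference_family k \<mu> \<Sigma>" and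
    proj: "image_mset (\<lambda>B. image_mset fst (mset_set B)) C = \<Sigma>" and
    L: "\<And>g. 0 \<notin># L g" and
    diff: "family_diff_list (image_mset mset_set C) =
      (\<Sum>g\<in>UNIV. image_mset (Pair g)
         (mset_mult (mset_set (nonzero_powers ((CARD('f) - 1) div d))) (L g)))"
    unfolding sdf_of_type_wrt_def by blast
  from proj assms(2) obtain B where B: "B \<in># C" by (metis image_mset_empty multiset_nonemptyE)
  have "image_mset fst (mset_set B) \<in># \<Sigma>" using B proj by auto
  then have card: "card B = k"
    using sdf unfolding strong_difference_family_def by fastforce
  have "inj_on snd B"
  proof (rule inj_onI, rule ccontr)
    fix x y assume xy: "x \<in> B" "y \<in> B" "snd x = snd y" "x \<noteq> y"
    have "x - y \<in># diff_list (mset_set B)"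
      unfolding diff_list_def using xy
      by (auto simp: in_diff_count intro!: bexI[of _ x] imageI)
    then have "x - y \<in># family_diff_list (image_mset mset_set C)"
      unfolding family_diff_list_def using B by auto
    then obtain g where "x - y \<in># image_mset (Pair g)
        (mset_mult (mset_set (nonzero_powers ((CARD('f) - 1) div d))) (L g))"
      unfolding diff by (auto simp: set_mset_sum)
    then have "snd x - snd y \<in># mset_mult (mset_set (nonzero_powers ((CARD('f) - 1) div d))) (L g)"
      unfolding minus_prod_def by auto
    then show False using xy(3) L[of g]
      by (auto simp: mset_mult_def nonzero_powers_def)
  qed
  then have "card B \<le> CARD('f)" by (metis card_image card_mono finite subset_UNIV)
  then show ?thesis using card by simp
qed

end

theory Submission
  imports Defs "HOL-Computational_Algebra.Polynomial"
begin

text \<open>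
  Let \<open>u\<close> be a square root of \<open>-1\<close> in the field, so that the relevant power group is
  \<open>C = {1, u, -1, -u}\<close>.  By orbit decomposition, a multiset on \<open>G \<times> \<bbbF>\<close> without zero second
  coordinates has the form required of a difference multiset as soon as it is invariant under
  scaling second coordinates by \<open>C\<close>.  The block of the first family is lifted to a set that is
  stable under the automorphism \<open>(g, y) \<mapsto> (-g, u y)\<close>; composing with the negation symmetry of
  any difference multiset shows that its differences are invariant under \<open>(g, y) \<mapsto> (g, -u y)\<close>.
  The blocks of the second family come in groups of four equal ones; any lift of such a block with
  distinct second coordinates, together with its scalings by \<open>C\<close>, has invariant differences.
\<close>

subsection \<open>Difference multisets\<close>

lemma diff_list_empty [simp]: "diff_list {#} = {#}"
  by (simp add: diff_list_def)

lemma sum_mset_add_mset: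
  "(\<Sum>x\<in>#F. add_mset (f x) (g x)) = image_mset f F + (\<Sum>x\<in>#F. g x)"
  by (induction F) simp_all

text \<open>The new differences are those in which \<open>a\<close> occupies one of the two
  positions. This recursion lets the identities for \<open>diff_list\<close> be proved by induction
  on the multiset.\<close>

lemma diff_list_add_mset:
  "diff_list (add_mset a F) =
     diff_list F + image_mset (\<lambda>y. a - y) F + image_mset (\<lambda>y. y - a) F"
proof -
  have "(\<Sum>x\<in>#F. image_mset ((-) x) (add_mset a F - {#x#})) =
      (\<Sum>x\<in>#F. add_mset (x - a) (image_mset ((-) x) (F - {#x#})))"
    by (rule arg_cong[of _ _ sum_mset], rule image_mset_cong)
       (auto dest!: multi_member_split)
  also have "\<dots> = image_mset (\<lambda>x. x - a) F + (\<Sum>x\<in>#F. image_mset ((-) x) (F - {#x#}))"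
    by (rule sum_mset_add_mset)
  finally show ?thesis
    by (simp add: diff_list_def ac_simps)
qed

text \<open>Swapping the two positions of an ordered pair negates its difference.\<close>

lemma image_mset_uminus_diff_list:
  "image_mset uminus (diff_list F) = diff_list F"
  by (induction F) (simp_all add: diff_list_add_mset multiset.map_comp comp_def ac_simps)

lemma image_mset_diff_list:
  assumes "\<And>a b. f (a - b) = f a - f b"
  shows "image_mset f (diff_list F) = diff_list (image_mset f F)"
  by (induction F) (simp_all add: diff_list_add_mset multiset.map_comp comp_def assms)

lemma family_diff_list_add [simp]:
  "family_diff_list (A + B) = family_diff_list A + family_diff_list B"
  by (simp add: family_diff_list_def)

lemma family_diff_list_add_mset [simp]:
  "family_diff_list (add_mset A \<Sigma>) = diff_list A + family_diff_list \<Sigma>"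
  by (simp add: family_diff_list_def)

lemma family_diff_list_empty [simp]: "family_diff_list {#} = {#}"
  by (simp add: family_diff_list_def)

lemma image_mset_family_diff_list:
  assumes "\<And>a b. f (a - b) = f a - f b"
  shows "image_mset f (family_diff_list \<Sigma>) = family_diff_list (image_mset (image_mset f) \<Sigma>)"
  by (induction \<Sigma>) (simp_all add: family_diff_list_def image_mset_diff_list assms)

lemma snd_diff_list_nonzero:
  assumes "inj_on snd B" "finite B" "p \<in># diff_list (mset_set B)"
  shows "snd p \<noteq> 0"
proof -
  obtain a b where "a \<in> B" "b \<in># mset_set B - {#a#}" "p = a - b"
    using assms by (auto simp: diff_list_def)
  \<comment> \<open>In \<open>mset_set B\<close> every element has multiplicity one, so removing
    \<open>a\<close> leaves no copy of it.\<close>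
  moreover from this have "b \<in> B" "b \<noteq> a"
    using assms(2) by (auto simp: mset_set_Diff[of B "{a}", simplified, symmetric])
  ultimately show ?thesis
    using assms(1) by (auto simp: inj_on_def)
qed

subsection \<open>Powers in a finite field\<close>

text \<open>Multiplication by \<open>x\<close> permutes the nonzero elements, hence preserves their
  product, which can then be cancelled.\<close>

lemma power_card_minus_1_eq_1:
  fixes x :: "'f::{finite, field}"
  assumes "x \<noteq> 0"
  shows "x ^ (CARD('f) - 1) = 1"
proof -
  have "bij_betw ((*) x) (UNIV - {0}) (UNIV - {0})"
    by (rule bij_betw_byWitness[where f' = "\<lambda>y. y / x"]) (use assms in auto)
  then have "(\<Prod>y\<in>UNIV - {0}. x * y) = \<Prod>(UNIV - {0})"
    using prod.reindex_bij_betw[of "(*) x" "UNIV - {0}" "UNIV - {0}" "\<lambda>y. y"] by simp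
  then have "x ^ card (UNIV - {0 :: 'f}) * \<Prod>(UNIV - {0}) = \<Prod>(UNIV - {0})"
    by (simp add: prod.distrib)
  moreover have "\<Prod>(UNIV - {0 :: 'f}) \<noteq> 0"
    by simp
  ultimately show ?thesis
    by (simp add: card_Diff_singleton)
qed

lemma card_nth_roots_le:
  fixes c :: "'f::field"
  assumes "n > 0"
  shows "finite {x. x ^ n = c}" and "card {x. x ^ n = c} \<le> n"
proof -
  let ?p = "monom 1 n - [:c:]"
  \<comment> \<open>As \<open>n > 0\<close>, the constant \<open>c\<close> only affects coefficient
    0; so \<open>?p\<close> is nonzero and has at most \<open>n\<close> roots.\<close>
  have "coeff ?p n = 1"
    using assms by (simp add: coeff_pCons split: nat.split)
  then have "?p \<noteq> 0" by (metis coeff_0 zero_neq_one)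
  moreover have roots: "{x. x ^ n = c} = {x. poly ?p x = 0}"
    by (simp add: poly_monom)
  moreover have "degree ?p \<le> n"
    by (intro degree_diff_le) (auto simp: degree_monom_eq)
  ultimately show "finite {x. x ^ n = c}" "card {x. x ^ n = c} \<le> n"
    using poly_roots_finite[of ?p] card_poly_roots_bound[of ?p] by auto
qed

text \<open>
  The fibres of \<open>x \<mapsto> x ^ e\<close> have at most \<open>e\<close> elements, which bounds the number of powers from
  below; being roots of \<open>X ^ d - 1\<close> bounds it from above.
\<close>
lemma nonzero_powers_eq_roots_of_unity:
  assumes "d * e = CARD('f::{finite, field}) - 1"
  shows "nonzero_powers e = {c :: 'f. c ^ d = 1}"
    and "card {c :: 'f. c ^ d = 1} = d"
proof -
  \<comment> \<open>A field has at least two elements, so the product \<open>d * e\<close> is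
    positive.\<close>
  have "card {0, 1 :: 'f} \<le> CARD('f)"
    by (intro card_mono) auto
  then have pos: "d > 0" "e > 0"
    using assms by (auto intro!: Nat.gr0I)
  have sub: "nonzero_powers e \<subseteq> {c :: 'f. c ^ d = 1}"
    using power_card_minus_1_eq_1 assms
    by (auto simp: nonzero_powers_def mult.commute simp flip: power_mult)
  have "(UNIV - {0 :: 'f}) = (\<Union>c\<in>nonzero_powers e. {x. x ^ e = c} - {0})"
    by (auto simp: nonzero_powers_def)
  then have "card (UNIV - {0 :: 'f}) \<le> (\<Sum>c\<in>nonzero_powers e. card ({x :: 'f. x ^ e = c} - {0}))"
    by (metis card_UN_le finite)
  also have "\<dots> \<le> (\<Sum>c\<in>(nonzero_powers e :: 'f set). e)"
    by (intro sum_mono order.trans[OF card_mono card_nth_roots_le(2)[OF pos(2)]]) auto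
  finally have "d * e \<le> card (nonzero_powers e :: 'f set) * e"
    using assms by (simp add: card_Diff_singleton)
  then have "d \<le> card (nonzero_powers e :: 'f set)"
    using pos by simp
  then show "nonzero_powers e = {c :: 'f. c ^ d = 1}" "card {c :: 'f. c ^ d = 1} = d"
    using sub card_nth_roots_le[OF pos(1), of "1 :: 'f"] card_mono[OF _ sub]
      card_subset_eq[OF _ sub] by fastforce+
qed

text \<open>At most two elements square to 1, so some fourth root of unity \<open>u\<close> does
  not; then \<open>u ^ 2\<close> is the other root of \<open>X^2 - 1\<close>, namely -1, which
  therefore differs from 1.\<close>

lemma sqrt_minus_one_exists:
  assumes "card {c :: 'f::field. c ^ 4 = 1} = 4"
  obtains u :: "'f::field" where "u ^ 2 = -1" and "(1 :: 'f) \<noteq> -1"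
    and "{c :: 'f. c ^ 4 = 1} = {1, -1, u, -u}"
proof -
  have "\<not> {c :: 'f. c ^ 4 = 1} \<subseteq> {c. c ^ 2 = 1}"
    using card_mono[OF card_nth_roots_le(1)[of 2 "1 :: 'f"], of "{c. c ^ 4 = 1}"]
      card_nth_roots_le(2)[of 2 "1 :: 'f"] assms by auto
  then obtain u :: 'f where u: "u ^ 4 = 1" "u ^ 2 \<noteq> 1" by auto
  have "(u ^ 2 - 1) * (u ^ 2 + 1) = u ^ 4 - 1"
    by (simp add: algebra_simps flip: power_add)
  then have u2: "u ^ 2 = -1"
    using u by (simp add: eq_neg_iff_add_eq_0)
  then have ne: "(1 :: 'f) \<noteq> -1" using u by auto
  have fact: "c ^ 4 - 1 = (c - 1) * (c + 1) * ((c - u) * (c + u))" for c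
  proof -
    have "(c - 1) * (c + 1) * ((c - u) * (c + u)) = (c ^ 2 - 1) * (c ^ 2 - u ^ 2)"
      by (simp add: algebra_simps power2_eq_square)
    also have "\<dots> = c ^ 4 - 1"
      unfolding u2 by (simp add: algebra_simps flip: power_add)
    finally show ?thesis by simp
  qed
  have "c ^ 4 = 1 \<longleftrightarrow> c \<in> {1, -1, u, -u}" for c
    using fact[of c] by (auto simp: eq_neg_iff_add_eq_0)
  then show ?thesis using that u2 ne by blast
qed

subsection \<open>Orbit decomposition\<close>

lemma nonzero_powers_closed:
  fixes a b :: "'f::field"
  shows "(1 :: 'f) \<in> nonzero_powers e"
    and "a \<in> nonzero_powers e \<Longrightarrow> b \<in> nonzero_powers e \<Longrightarrow> a * b \<in> nonzero_powers e"
    and "a \<in> nonzero_powers e \<Longrightarrow> inverse a \<in> nonzero_powers e"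
    and "a \<in> nonzero_powers e \<Longrightarrow> a \<noteq> 0"
  unfolding nonzero_powers_def
     apply (auto intro: exI[of _ 1])
   apply (metis mult_eq_0_iff power_mult_distrib)
  apply (metis nonzero_imp_inverse_nonzero power_inverse)
  done

lemma mset_mult_empty [simp]: "mset_mult A {#} = {#}"
  by (simp add: mset_mult_def)

lemma mset_mult_add_mset:
  "mset_mult A (add_mset b B) = image_mset (\<lambda>a. a * b) A + mset_mult A B"
  by (induction A) (simp_all add: mset_mult_def)

lemma size_mset_mult [simp]: "size (mset_mult A B) = size A * size B"
  by (induction A) (simp_all add: mset_mult_def)

lemma image_mset_sum: "image_mset f (\<Sum>x\<in>A. g x) = (\<Sum>x\<in>A. image_mset f (g x))"
  by (induction A rule: infinite_finite_induct) simp_all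

lemma sum_image_Pair_update:
  fixes h :: "'g::finite"
  shows "(\<Sum>g\<in>UNIV. image_mset (Pair g) ((F(h := E + F h)) g)) =
    image_mset (Pair h) E + (\<Sum>g\<in>UNIV. image_mset (Pair g) (F g))"
  by (subst (1 2) sum.remove[of UNIV h]) (auto simp: ac_simps intro!: sum.cong)

text \<open>Induction on the size: the orbit of one point is split off, its representative is
  recorded in \<open>L\<close>, and the remainder is again invariant. A nonzero second coordinate
  makes the action on the orbit free, so the orbit is a full copy of the power group.\<close>

lemma orbit_decomposition:
  fixes M :: "('g::finite \<times> 'f::{finite, field}) multiset"
  assumes "\<And>g y c. c \<in> nonzero_powers e \<Longrightarrow> count M (g, c * y) = count M (g, y)"
    and "\<And>p. p \<in># M \<Longrightarrow> snd p \<noteq> 0"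
  shows "\<exists>L. (\<forall>g. 0 \<notin># L g) \<and>
    M = (\<Sum>g\<in>UNIV. image_mset (Pair g) (mset_mult (mset_set (nonzero_powers e)) (L g)))"
  using assms
proof (induction "size M" arbitrary: M rule: less_induct)
  case less
  let ?C = "nonzero_powers e :: 'f set"
  show ?case
  proof (cases "M = {#}")
    case True
    then show ?thesis by (intro exI[of _ "\<lambda>_. {#}"]) simp
  next
    case False
    then obtain h y where hy: "(h, y) \<in># M" by auto
    then have y: "y \<noteq> 0" using less.prems(2) by fastforce
    let ?O = "Pair h ` (\<lambda>c. c * y) ` ?C"
    have orbit: "image_mset (Pair h) (image_mset (\<lambda>c. c * y) (mset_set ?C)) = mset_set ?O"
      using y by (simp add: image_mset_mset_set inj_on_def)
    \<comment> \<open>All points of the orbit have the same positive count in \<open>M\<close> as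
      \<open>(h, y)\<close>.\<close>
    have le: "mset_set ?O \<subseteq># M"
      using hy by (auto simp: subseteq_mset_def count_mset_set' Suc_le_eq less.prems(1)
        simp flip: count_greater_zero_iff)
    define N where "N = M - mset_set ?O"
    have M: "M = mset_set ?O + N" using le by (simp add: N_def)
    have "?O \<noteq> {}" using nonzero_powers_closed(1) by auto
    then have "size N < size M" unfolding M by (simp add: card_gt_0_iff)
    moreover have "count N (g, c * z) = count N (g, z)" if c: "c \<in> ?C" for g z c
    proof -
      have "(g, c * z) \<in> ?O \<longleftrightarrow> (g, z) \<in> ?O"
      proof
        assume "(g, c * z) \<in> ?O"
        then obtain b where b: "b \<in> ?C" "c * z = b * y" "g = h" by auto
        then have "z = (inverse c * b) * y"
          using nonzero_powers_closed(4)[OF c] by (simp add: field_simps)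
        then show "(g, z) \<in> ?O" using b nonzero_powers_closed(2,3) c by blast
      next
        assume "(g, z) \<in> ?O"
        then obtain b where b: "b \<in> ?C" "z = b * y" "g = h" by auto
        then have "c * z = (c * b) * y" by simp
        then show "(g, c * z) \<in> ?O" using b nonzero_powers_closed(2) c by blast
      qed
      then show ?thesis
        using less.prems(1)[OF c, of g z] by (simp add: N_def count_mset_set')
    qed
    moreover have "snd p \<noteq> 0" if "p \<in># N" for p
      using less.prems(2) that by (simp add: M)
    ultimately obtain L where L: "\<forall>g. 0 \<notin># L g"
      "N = (\<Sum>g\<in>UNIV. image_mset (Pair g) (mset_mult (mset_set ?C) (L g)))"
      using less.hyps by blast
    let ?L = "L(h := add_mset y (L h))"
    have upd: "(\<lambda>g. mset_mult (mset_set ?C) (?L g)) =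
      (\<lambda>g. mset_mult (mset_set ?C) (L g))
        (h := image_mset (\<lambda>c. c * y) (mset_set ?C) + mset_mult (mset_set ?C) (L h))"
      by (auto simp: mset_mult_add_mset)
    have "M = (\<Sum>g\<in>UNIV. image_mset (Pair g) (mset_mult (mset_set ?C) (?L g)))"
      unfolding M orbit[symmetric] L(2)
      using sum_image_Pair_update[of "\<lambda>g. mset_mult (mset_set ?C) (L g)" h
          "image_mset (\<lambda>c. c * y) (mset_set ?C)"]
      unfolding upd[symmetric] by simp
    moreover have "\<forall>g. 0 \<notin># ?L g" using L(1) y by auto
    ultimately show ?thesis by blast
  qed
qed

section \<open>Scaling second coordinates, and a criterion for type \<open>d\<close>\<close>

definition scale_snd :: "'f::times \<Rightarrow> 'g \<times> 'f \<Rightarrow> 'g \<times> 'f" where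
  "scale_snd c p = (fst p, c * snd p)"

lemma fst_scale_snd [simp]: "fst (scale_snd c p) = fst p"
  and snd_scale_snd [simp]: "snd (scale_snd c p) = c * snd p"
  by (simp_all add: scale_snd_def)

lemma scale_snd_mult: "scale_snd (a :: 'f::semigroup_mult) (scale_snd b p) = scale_snd (a * b) p"
  by (simp add: scale_snd_def mult.assoc)

lemma inj_scale_snd: "(c :: 'f::field) \<noteq> 0 \<Longrightarrow> inj (scale_snd c)"
  by (auto simp: inj_on_def scale_snd_def)

lemma scale_snd_diff:
  "scale_snd (c :: 'f::ring) (a - b) = scale_snd c a - scale_snd c b"
  by (simp add: scale_snd_def minus_prod_def right_diff_distrib)

lemma count_scale_snd_eq:
  fixes c :: "'f::field"
  assumes "image_mset (scale_snd c) M = M" "c \<noteq> 0"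
  shows "count M (g, c * y) = count M (g, y)"
proof -
  have "scale_snd c -` {(g, c * y)} = {(g, y)}"
    using assms(2) by (auto simp: scale_snd_def)
  then have "count (image_mset (scale_snd c) M) (g, c * y) = count M (g, y)"
    by (cases "(g, y) \<in># M") (simp_all add: count_image_mset not_in_iff)
  then show ?thesis by (simp only: assms(1))
qed

text \<open>The invariance alone forces the divisibility of \<open>\<mu>\<close> and the sizes of the multisets \<open>L g\<close>.\<close>
lemma sdf_of_type_wrtI:
  fixes \<CC> :: "('g::{finite, group_add} \<times> 'f::{finite, field}) set multiset"
  assumes sdf: "strong_difference_family k \<mu> \<Sigma>"
    and cong: "[CARD('f) = 1] (mod d)"
    and proj: "image_mset (\<lambda>B. image_mset fst (mset_set B)) \<CC> = \<Sigma>"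
    and inj: "\<And>B. B \<in># \<CC> \<Longrightarrow> inj_on snd B"
    and inv: "\<And>c :: 'f. c ^ d = 1 \<Longrightarrow>
      image_mset (scale_snd c) (family_diff_list (image_mset mset_set \<CC>)) =
        family_diff_list (image_mset mset_set \<CC>)"
  shows "sdf_of_type_wrt TYPE('f) d k \<mu> \<Sigma>"
proof -
  define e where "e = (CARD('f) - 1) div d"
  let ?D = "family_diff_list (image_mset mset_set \<CC>)" and ?C = "nonzero_powers e :: 'f set"
  have "d dvd CARD('f) - 1"
    using cong by (simp add: cong_altdef_nat Suc_leI)
  then have de: "d * e = CARD('f) - 1" by (simp add: e_def)
  note roots = nonzero_powers_eq_roots_of_unity[OF de]
  have "count ?D (g, c * y) = count ?D (g, y)" if "c \<in> ?C" for g c y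
    using that inv[of c] nonzero_powers_closed(4)[OF that] roots(1)
    by (intro count_scale_snd_eq) auto
  moreover have "snd p \<noteq> 0" if "p \<in># ?D" for p
    using that inj by (auto simp: family_diff_list_def dest: snd_diff_list_nonzero[OF _ finite])
  ultimately obtain L where L: "\<forall>g. 0 \<notin># L g"
    "?D = (\<Sum>g\<in>UNIV. image_mset (Pair g) (mset_mult (mset_set ?C) (L g)))"
    using orbit_decomposition[of e ?D] by blast
  have size: "d * size (L g) = \<mu>" for g
  proof -
    \<comment> \<open>Occurrences of \<open>g\<close> in the projection are counted twice: the
      family gives \<open>\<mu>\<close>, the decomposition gives \<open>d\<close> for each entry of
      \<open>L g\<close>.\<close>
    have "image_mset fst ?D = repeat_mset \<mu> (mset_set UNIV)"
      using sdf proj image_mset_family_diff_list[of fst "image_mset mset_set \<CC>"]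
      by (simp add: strong_difference_family_def multiset.map_comp comp_def)
    then have "\<mu> = count (image_mset fst ?D) g" by simp
    also have "\<dots> = (\<Sum>h\<in>UNIV. count (replicate_mset (d * size (L h)) h) g)"
      unfolding L(2)
      by (simp add: image_mset_sum multiset.map_comp comp_def count_sum roots
          image_mset_const_eq)
    also have "\<dots> = d * size (L g)"
      by (simp add: if_distrib cong: if_cong)
    finally show ?thesis by simp
  qed
  have "d > 0" using de nonzero_powers_closed(1) roots by (metis card_gt_0_iff finite empty_iff)
  then have "d dvd \<mu>" "\<And>g. size (L g) = \<mu> div d"
    using size by (metis dvd_triv_left, metis nonzero_mult_div_cancel_left not_gr0)
  then show ?thesis
    unfolding sdf_of_type_wrt_def using sdf cong proj L e_def by blast
qed

subsection \<open>Lifting the base blocks\<close>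

lemma diff_list_scale_snd_invariant:
  fixes B :: "('g::ab_group_add \<times> 'f::field) set"
  assumes "map_prod uminus ((*) u) ` B = B" "finite B" "u \<noteq> 0"
  shows "image_mset (scale_snd (- u)) (diff_list (mset_set B)) = diff_list (mset_set B)"
proof -
  let ?\<phi> = "map_prod uminus ((*) u) :: 'g \<times> 'f \<Rightarrow> 'g \<times> 'f"
  have inj: "inj ?\<phi>" using assms(3) by (auto simp: inj_on_def)
  have "scale_snd (- u) = uminus \<circ> ?\<phi>" by (auto simp: fun_eq_iff scale_snd_def)
  then have "image_mset (scale_snd (- u)) (diff_list (mset_set B)) =
      image_mset uminus (image_mset ?\<phi> (diff_list (mset_set B)))"
    by (simp add: multiset.map_comp)
  \<comment> \<open>Commutativity of the group makes negation, and hence \<open>?\<phi>\<close>,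
    compatible with differences.\<close>
  also have "image_mset ?\<phi> (diff_list (mset_set B)) = diff_list (image_mset ?\<phi> (mset_set B))"
    by (rule image_mset_diff_list) (auto simp: algebra_simps)
  also have "image_mset ?\<phi> (mset_set B) = mset_set B"
    using image_mset_mset_set[OF inj_on_subset[OF inj], of B] assms by simp
  finally show ?thesis by (simp add: image_mset_uminus_diff_list)
qed

text \<open>Each quadruple is lifted to one 4-cycle \<open>(x, y)\<close>, \<open>(-x, u y)\<close>,
  \<open>(x, -y)\<close>, \<open>(-x, -u y)\<close> of the automorphism, with \<open>y\<close>
  fresh. The coordinate 0 stays free for the extra zero of a block with
  \<open>k mod 4 = 1\<close>.\<close>

lemma symmetric_lift_exists:
  fixes x :: "nat \<Rightarrow> 'g::{finite, ab_group_add}" and u :: "'f::{finite, field}"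
  assumes u: "u ^ 2 = -1" and ne: "(1 :: 'f) \<noteq> -1" and "4 * m < CARD('f)"
  shows "\<exists>B :: ('g \<times> 'f) set. inj_on snd B \<and> 0 \<notin> snd ` B \<and>
    map_prod uminus ((*) u) ` B = B \<and>
    image_mset fst (mset_set B) = (\<Sum>i=1..m. {#x i, x i, - x i, - x i#})"
  using assms(3)
proof (induction m)
  case 0
  show ?case by (intro exI[of _ "{}"]) simp
next
  case (Suc m)
  let ?\<phi> = "map_prod uminus ((*) u) :: 'g \<times> 'f \<Rightarrow> 'g \<times> 'f"
  obtain B :: "('g \<times> 'f) set" where B: "inj_on snd B" "0 \<notin> snd ` B" "?\<phi> ` B = B"
    "image_mset fst (mset_set B) = (\<Sum>i=1..m. {#x i, x i, - x i, - x i#})"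
    using Suc by auto
  have "card B = size (image_mset fst (mset_set B))" by simp
  also have "\<dots> = 4 * m" unfolding B(4) by (simp add: size_multiset_sum)
  \<comment> \<open>The \<open>4 * m\<close> used coordinates and 0 do not exhaust the field, since
    \<open>4 * Suc m < CARD('f)\<close>.\<close>
  finally have "card (insert 0 (snd ` B)) < CARD('f)"
    using card_image[OF B(1)] B(2) Suc.prems by simp
  then obtain y where y: "y \<notin> snd ` B" "y \<noteq> 0"
    by (metis UNIV_eq_I insertCI less_irrefl)
  have u0: "u \<noteq> 0" using u by auto
  have uu: "u * (u * z) = - z" for z
    using u by (simp add: power2_eq_square flip: mult.assoc)
  have closed: "u * z \<in> snd ` B" if "z \<in> snd ` B" for z
  proof -
    from that obtain p where "p \<in> B" "z = snd p" by auto
    then have "?\<phi> p \<in> B" "u * z = snd (?\<phi> p)" using B(3) by auto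
    then show ?thesis by blast
  qed
  \<comment> \<open>The used coordinates are closed under multiplication by \<open>u\<close>, and
    powers of \<open>u\<close> lead from any \<open>z\<close> in the orbit back to \<open>y\<close>;
    so a used \<open>z\<close> would make \<open>y\<close> used.\<close>
  have notin: "z \<notin> snd ` B" if "z \<in> {y, - y, u * y, - (u * y)}" for z
  proof
    assume "z \<in> snd ` B"
    then have "z \<in> snd ` B" "u * z \<in> snd ` B" "- z \<in> snd ` B" "- (u * z) \<in> snd ` B"
      using closed uu by metis+
    moreover have "y \<in> {z, u * z, - z, - (u * z)}" using that uu by auto
    ultimately show False using y(1) by blast
  qed
  have "u \<noteq> 1" "u \<noteq> -1" using u ne by auto
  moreover have "y \<noteq> - y"
    using ne y(2) by (metis mult_cancel_right1 mult_minus_left)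
  moreover have "u * y \<noteq> - (u * y)"
    using ne y(2) u0 by (metis mult_cancel_right1 mult_minus_left mult_eq_0_iff)
  moreover have "u * y \<noteq> - y" "u * y \<noteq> y"
    using \<open>u \<noteq> 1\<close> \<open>u \<noteq> -1\<close> y(2) by (metis mult_cancel_right mult_minus1 mult_1)+
  moreover from this have "y \<noteq> - (u * y)"
    by (metis minus_minus)
  ultimately have dist: "distinct [y, - y, u * y, - (u * y)]"
    by (metis distinct_length_2_or_more distinct_singleton neg_equal_iff_equal)
  define N where
    "N = {(x (Suc m), y), (x (Suc m), - y), (- x (Suc m), u * y), (- x (Suc m), - (u * y))}"
  have snd_N: "snd ` N = {y, - y, u * y, - (u * y)}" by (simp add: N_def)
  then have sep: "snd ` B \<inter> snd ` N = {}" using notin by blast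
  then have disj: "B \<inter> N = {}" by blast
  \<comment> \<open>The four second coordinates are distinct even when \<open>x (Suc m)\<close>
    equals its negative, so \<open>N\<close> has four points.\<close>
  have "card N = 4" "card (snd ` N) = 4"
    unfolding snd_N using dist by (simp_all add: N_def)
  then have "inj_on snd N" by (simp add: eq_card_imp_inj_on)
  then have "inj_on snd (B \<union> N)"
    unfolding inj_on_Un using B(1) sep by blast
  moreover have "0 \<notin> snd ` (B \<union> N)"
    unfolding image_Un snd_N using B(2) y(2) u0 by simp
  moreover have "?\<phi> ` N = N"
    by (simp add: N_def uu insert_commute)
  then have "?\<phi> ` (B \<union> N) = B \<union> N"
    by (simp add: image_Un B(3))
  moreover have "image_mset fst (mset_set N) =
      {#x (Suc m), x (Suc m), - x (Suc m), - x (Suc m)#}"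
    using dist by (simp add: N_def)
  then have "image_mset fst (mset_set (B \<union> N)) =
      (\<Sum>i=1..Suc m. {#x i, x i, - x i, - x i#})"
    by (simp add: mset_set_Union[OF finite finite disj] B(4))
  ultimately show ?case by blast
qed

lemma lift_exists:
  fixes A :: "'g multiset"
  assumes "size A \<le> CARD('f::finite)"
  shows "\<exists>B :: ('g \<times> 'f) set. finite B \<and> inj_on snd B \<and> image_mset fst (mset_set B) = A"
  using assms
proof (induction A)
  case empty
  show ?case by (intro exI[of _ "{}"]) simp
next
  case (add a A)
  then obtain B :: "('g \<times> 'f) set" where
    B: "finite B" "inj_on snd B" "image_mset fst (mset_set B) = A"
    by auto
  have "card (snd ` B) = size A"
    using B card_image by fastforce
  then have "snd ` B \<noteq> UNIV" using add.prems by auto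
  then obtain y where "y \<notin> snd ` B" by auto
  then have "inj_on snd (insert (a, y) B)" "(a, y) \<notin> B"
    using B(2) by (auto simp: inj_on_def, force)
  then show ?case using B by (intro exI[of _ "insert (a, y) B"]) simp
qed

text \<open>Scaling by the elements of a subgroup merely permutes the scalings by that subgroup.\<close>
lemma scaled_lifts_exist:
  fixes \<Sigma> :: "'g::{finite, ab_group_add} multiset multiset"
  assumes "\<And>A. A \<in># \<Sigma> \<Longrightarrow> size A \<le> CARD('f::{finite, field})"
    and d: "card {c :: 'f. c ^ d = 1} = d" and "d > 0"
  shows "\<exists>\<CC> :: ('g \<times> 'f) set multiset.
    image_mset (\<lambda>B. image_mset fst (mset_set B)) \<CC> = repeat_mset d \<Sigma> \<and>
    (\<forall>B\<in>#\<CC>. inj_on snd B) \<and>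
    (\<forall>c. c ^ d = 1 \<longrightarrow>
      image_mset (scale_snd c) (family_diff_list (image_mset mset_set \<CC>)) =
        family_diff_list (image_mset mset_set \<CC>))"
  using assms(1)
proof (induction \<Sigma>)
  case empty
  show ?case by (intro exI[of _ "{#}"]) simp
next
  case (add A \<Sigma>)
  let ?C = "{c :: 'f. c ^ d = 1}"
  let ?proj = "\<lambda>B :: ('g \<times> 'f) set. image_mset fst (mset_set B)"
  let ?D = "\<lambda>\<CC> :: ('g \<times> 'f) set multiset. family_diff_list (image_mset mset_set \<CC>)"
  obtain \<CC> :: "('g \<times> 'f) set multiset" where
    \<CC>: "image_mset ?proj \<CC> = repeat_mset d \<Sigma>" "\<forall>B\<in>#\<CC>. inj_on snd B"
      "\<forall>c. c ^ d = 1 \<longrightarrow> image_mset (scale_snd c) (?D \<CC>) = ?D \<CC>"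
    using add by auto
  obtain B :: "('g \<times> 'f) set" where B: "inj_on snd B" "?proj B = A"
    using lift_exists[of A, where 'f = 'f] add.prems by auto
  have nz: "c \<noteq> 0" if "c \<in> ?C" for c using that \<open>d > 0\<close> by (auto simp: power_0_left)
  \<comment> \<open>Indexing by the roots of unity yields \<open>d\<close> members even should some
    scaled sets coincide.\<close>
  define S where "S = image_mset (\<lambda>c. scale_snd c ` B) (mset_set ?C)"
  have scaled: "mset_set (scale_snd c ` B) = image_mset (scale_snd c) (mset_set B)"
    if "c \<in> ?C" for c
    using image_mset_mset_set[OF inj_on_subset[OF inj_scale_snd[OF nz[OF that]]], of B] by simp
  have "image_mset ?proj S = image_mset (\<lambda>_. A) (mset_set ?C)"
    unfolding S_def multiset.map_comp comp_def
    by (rule image_mset_cong) (simp add: scaled multiset.map_comp comp_def B(2))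
  then have 1: "image_mset ?proj S = replicate_mset d A"
    using d by (simp add: image_mset_const_eq)
  have "inj_on snd (scale_snd c ` B)" if "c \<in> ?C" for c
    by (rule inj_on_imageI) (use B(1) nz[OF that] in \<open>simp add: inj_on_def\<close>)
  then have 2: "\<forall>B\<in>#S. inj_on snd B"
    by (simp add: S_def)
  have DS: "?D S = (\<Sum>c\<in>?C. image_mset (scale_snd c) (diff_list (mset_set B)))"
    unfolding S_def family_diff_list_def multiset.map_comp comp_def sum_unfold_sum_mset
    by (rule arg_cong[of _ _ sum_mset], rule image_mset_cong)
       (simp add: scaled image_mset_diff_list scale_snd_diff)
  have 3: "image_mset (scale_snd c) (?D S) = ?D S" if c: "c ^ d = 1" for c
  proof -
    have "bij_betw ((*) c) ?C ?C"
      by (rule bij_betw_byWitness[where f' = "\<lambda>b. b / c"])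
         (use nz[of c] c in \<open>auto simp: power_mult_distrib power_divide\<close>)
    have "image_mset (scale_snd c) (?D S) =
        (\<Sum>b\<in>?C. image_mset (scale_snd (c * b)) (diff_list (mset_set B)))"
      unfolding DS by (simp add: image_mset_sum multiset.map_comp comp_def scale_snd_mult)
    also have "\<dots> = ?D S"
      unfolding DS by (rule sum.reindex_bij_betw) fact
    finally show ?thesis .
  qed
  show ?case
    using \<CC> 1 2 3 by (intro exI[of _ "S + \<CC>"]) (auto simp: repeat_mset_distrib_add_mset)
qed

section \<open>Grouping equal blocks and assembling the lifted family\<close>

lemma repeat_mset_if_dvd_count:
  assumes "\<And>a. a \<in># A \<Longrightarrow> d dvd count A a"
  obtains B where "A = repeat_mset d B" and "set_mset B \<subseteq> set_mset A"
proof -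
  let ?B = "\<Sum>a\<in>set_mset A. replicate_mset (count A a div d) a"
  have "count ?B a = count A a div d" for a
    by (simp add: count_sum if_distrib not_in_iff cong: if_cong)
  then have "A = repeat_mset d ?B"
    using assms by (intro multiset_eqI) (metis count_repeat_mset dvd_0_right dvd_mult_div_cancel not_in_iff)
  moreover have "set_mset ?B \<subseteq> set_mset A"
    by (auto simp: set_mset_sum split: if_splits)
  ultimately show ?thesis using that by blast
qed

text \<open>The field type stands for an arbitrary \<open>q\<close> congruent to 1 modulo 4; the
  bound \<open>k \<le> CARD('f)\<close> is the necessary condition found in
  \<open>sdf_of_type_wrt_imp_le\<close>.\<close>

theorem proposition3:
  fixes \<Sigma> \<Sigma>1 \<Sigma>2 :: "'g::{finite, ab_group_add} multiset multiset"
    and k \<mu> :: nat and x :: "nat \<Rightarrow> 'g"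
  assumes "odd CARD('g)"
    and "strong_difference_family k \<mu> \<Sigma>"
    and "\<Sigma> = \<Sigma>1 + \<Sigma>2"
    and "k mod 4 = 0 \<and> \<Sigma>1 = {# \<Sum>i=1..k div 4. {#x i, x i, - x i, - x i#} #} \<or>
         k mod 4 = 1 \<and> \<Sigma>1 = {# {#0#} + (\<Sum>i=1..k div 4. {#x i, x i, - x i, - x i#}) #}"
    and "0 \<notin># diff_list (\<Sum>i=1..k div 4. {#x i, - x i#})"
    and "\<forall>A\<in>#\<Sigma>2. 4 dvd count \<Sigma>2 A \<and> 0 \<notin># diff_list A"
    and "[CARD('f::{finite, field}) = 1] (mod 4)"
    and "k \<le> CARD('f)"
  shows "sdf_of_type_wrt TYPE('f) 4 k \<mu> \<Sigma>"
proof -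
  let ?proj = "\<lambda>B :: ('g \<times> 'f) set. image_mset fst (mset_set B)"
  let ?D = "\<lambda>\<CC> :: ('g \<times> 'f) set multiset. family_diff_list (image_mset mset_set \<CC>)"
  have mod: "CARD('f) mod 4 = 1" using assms(7) by (simp add: cong_def)
  then have "4 * ((CARD('f) - 1) div 4) = CARD('f) - 1" by presburger
  note roots4 = nonzero_powers_eq_roots_of_unity(2)[OF this]
  then obtain u :: 'f where u: "u ^ 2 = -1" "(1 :: 'f) \<noteq> -1"
    and roots: "{c :: 'f. c ^ 4 = 1} = {1, -1, u, -u}"
    by (rule sqrt_minus_one_exists)
  have u0: "u \<noteq> 0" using u by auto
  \<comment> \<open>Strict, because the left side is divisible by 4 and the order of the field is
    not.\<close>
  have "4 * (k div 4) < CARD('f)" using assms(8) mod by presburger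
  from symmetric_lift_exists[OF u this, of x]
  obtain B0 :: "('g \<times> 'f) set" where B0: "inj_on snd B0" "0 \<notin> snd ` B0"
    "map_prod uminus ((*) u) ` B0 = B0"
    "?proj B0 = (\<Sum>i=1..k div 4. {#x i, x i, - x i, - x i#})"
    by blast
  obtain B where B: "inj_on snd B" "map_prod uminus ((*) u) ` B = B" "{#?proj B#} = \<Sigma>1"
  proof (cases "k mod 4 = 0")
    case True
    then show ?thesis using assms(4) B0 that by auto
  next
    case False
    \<comment> \<open>The extra zero of the block is lifted to \<open>(0, 0)\<close>, a fixed point
      of the automorphism whose second coordinate was kept free.\<close>
    have "(0, 0) \<notin> B0" using B0(2) by force
    moreover have "inj_on snd (insert (0, 0) B0)" using B0(1,2) by (auto simp: inj_on_def)
    ultimately show ?thesis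
      using False assms(4) B0 that[of "insert (0, 0) B0"] by auto
  qed
  obtain \<Sigma>' where \<Sigma>': "\<Sigma>2 = repeat_mset 4 \<Sigma>'" "set_mset \<Sigma>' \<subseteq> set_mset \<Sigma>2"
    using repeat_mset_if_dvd_count[of \<Sigma>2 4] assms(6) by blast
  have "size A \<le> CARD('f)" if "A \<in># \<Sigma>'" for A
    using that \<Sigma>'(2) assms(2,3,8) by (auto simp: strong_difference_family_def)
  from scaled_lifts_exist[of \<Sigma>', OF this roots4]
  obtain \<CC> :: "('g \<times> 'f) set multiset" where \<CC>: "image_mset ?proj \<CC> = \<Sigma>2"
      "\<forall>B\<in>#\<CC>. inj_on snd B"
      "\<forall>c. c ^ 4 = 1 \<longrightarrow> image_mset (scale_snd c) (?D \<CC>) = ?D \<CC>"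
    unfolding \<Sigma>'(1) by auto
  let ?B = "diff_list (mset_set B)"
  have inv_u: "image_mset (scale_snd (- u)) ?B = ?B"
    using diff_list_scale_snd_invariant[OF B(2) finite u0] .
  have comp: "image_mset (scale_snd (a * b)) ?B = ?B"
    if "image_mset (scale_snd a) ?B = ?B" "image_mset (scale_snd b) ?B = ?B" for a b
  proof -
    have "scale_snd (a * b) = scale_snd a \<circ> (scale_snd b :: 'g \<times> 'f \<Rightarrow> _)"
      by (simp add: fun_eq_iff scale_snd_mult)
    then show ?thesis using that by (metis multiset.map_comp)
  qed
  \<comment> \<open>The powers of \<open>- u\<close> are all four fourth roots of unity, so
    invariance under \<open>- u\<close> suffices.\<close>
  have "- u * - u = -1" using u(1) by (simp add: power2_eq_square)
  then have inv_neg: "image_mset (scale_snd (- 1)) ?B = ?B"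
    using comp[OF inv_u inv_u] by simp
  have "image_mset (scale_snd c) ?B = ?B" if "c ^ 4 = 1" for c
  proof -
    have "c \<in> {1, -1, u, -u}" using that roots by blast
    moreover have "scale_snd (1 :: 'f) = (id :: 'g \<times> 'f \<Rightarrow> _)" by (simp add: fun_eq_iff scale_snd_def)
    ultimately show ?thesis
      using inv_u inv_neg comp[OF inv_neg inv_u] by auto
  qed
  then have "image_mset (scale_snd c) (?D (add_mset B \<CC>)) = ?D (add_mset B \<CC>)"
    if "c ^ 4 = 1" for c
    using \<CC>(3) that by simp
  then show ?thesis
    using assms(2,3,7) B \<CC> by (intro sdf_of_type_wrtI[of _ _ _ _ "add_mset B \<CC>"]) auto
qed

end
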